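(* Let $\kappa(t)$ denote the number of powerful numbers in the interval $[1,t]$. Golomb proved that $$ct^{1/2} - 3t^{1/3} \leq \kappa(t) \leq ct^{1/2},$$ where $c := \zeta(3/2)/\zeta(3) \approx 2.1733$. Consequently, $\kappa(t)/t \to 0$ as $t \to \infty$. If $$\Delta(t) := \{ \delta = \ell - m \in \mathbb{N} \mid 1 \leq m < \ell \leq t,\ \delta \text{ powerful},\ \gcd(\ell,m)=1 \},$$ then $|\Delta(t)| = \kappa(t)$. Thus, $|\Delta(t)|/t \to 0$ as $t \to \infty$.
   Context: A positive integer $a$ is called powerful if $p^2$ divides $a$ for every prime $p$ that divides $a$; otherwise it is called nonpowerful. Here $\ell$ and $m$ are integers, $\mathbb{N}$ denotes the set of positive integers, $|\cdot|$ denotes cardinality, and $\zeta$ denotes the Riemann zeta function.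
   Formalization: The equality |Δ(t)| = κ(t) fails when ⌊t⌋ is powerful (e.g. |Δ(4)| = 1 but κ(4) = 2); what is proved for t ≥ 1 is |Δ(t)| = κ(t) when ⌊t⌋ is nonpowerful and |Δ(t)| + 1 = κ(t) when ⌊t⌋ is powerful. *)

theory Defs
  imports "HOL-Analysis.Analysis" "HOL-Computational_Algebra.Primes"
begin

definition powerful :: "nat \<Rightarrow> bool" where
  "powerful a \<longleftrightarrow> 0 < a \<and> (\<forall>p. prime p \<and> p dvd a \<longrightarrow> p\<^sup>2 dvd a)"

definition kappa :: "real \<Rightarrow> nat" where
  "kappa t = card {a::nat. powerful a \<and> 1 \<le> real a \<and> real a \<le> t}"

definition Delta :: "real \<Rightarrow> nat set" where
  "Delta t = {\<delta>. \<exists>l m :: int. int \<delta> = l - m \<and> 1 \<le> m \<and> m < l \<and> real_of_int l \<le> t \<and>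
                powerful \<delta> \<and> gcd l m = 1}"

text \<open>Every element of \<open>Delta t\<close> is at most \<open>\<lfloor>t\<rfloor> - 1\<close>, whereas \<open>kappa t\<close> also counts
  \<open>\<lfloor>t\<rfloor>\<close> when it is powerful. So \<open>card (Delta t) = kappa t\<close> fails for exactly those
  \<open>t \<ge> 1\<close> with \<open>\<lfloor>t\<rfloor>\<close> powerful; e.g. \<open>Delta 1 = {}\<close> but \<open>kappa 1 = 1\<close>.\<close>

text \<open>The Dirichlet series of the Riemann zeta function. It represents zeta only for
  \<open>s > 1\<close>, which covers the two arguments 3/2 and 3 used below.\<close>

definition zeta :: "real \<Rightarrow> real" where
  "zeta s = (\<Sum>n. 1 / real (Suc n) powr s)"

definition golomb_const :: real where
  "golomb_const = zeta (3/2) / zeta 3"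

end

theory Submission
  imports Defs "HOL-Real_Asymp.Real_Asymp" "HOL-Computational_Algebra.Squarefree"
begin

text \<open>Every positive integer is uniquely \<open>b m\<^sup>2\<close> with \<open>b\<close> squarefree, and it is powerful iff
  \<open>b\<close> divides \<open>m\<close>; so the powerful numbers are uniquely \<open>b\<^sup>3 m\<^sup>2\<close> with \<open>b\<close> squarefree. Hence
  \<open>\<kappa>(t)\<close> is the sum of \<open>\<lfloor>(t / b\<^sup>3) powr (1/2)\<rfloor>\<close> over squarefree \<open>b \<le> t powr (1/3)\<close>, while the
  sum of \<open>b powr (-3/2)\<close> over all squarefree \<open>b\<close> is \<open>\<zeta>(3/2) / \<zeta>(3)\<close>. The error is at most the
  number of terms plus \<open>t powr (1/2)\<close> times a tail of the series for \<open>\<zeta>(3/2)\<close>. Tails are bounded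
  by comparing each term with an integral by the midpoint and trapezoidal rules, which also
  evaluates the constant numerically.\<close>

subsection \<open>Tails of the zeta series\<close>

text \<open>In the applications \<open>g n\<close> is the integral of the summand over a half-line,
  so \<open>g n - g (Suc n)\<close> is the integral over a unit interval.\<close>

lemma suminf_le_telescope:
  fixes f g :: "nat \<Rightarrow> real"
  assumes "\<And>n. 0 \<le> f n" and "\<And>n. f n \<le> g n - g (Suc n)" and "g \<longlonglongrightarrow> 0"
  shows "summable f" and "suminf f \<le> g 0"
proof -
  have s: "(\<lambda>n. g n - g (Suc n)) sums g 0"
    using telescope_sums'[OF assms(3)] by simp
  show *: "summable f"
    by (rule summable_comparison_test'[OF sums_summable[OF s], of 0]) (use assms in simp)
  show "suminf f \<le> g 0"
    using sums_le[OF assms(2) summable_sums[OF *] s] .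
qed

lemma suminf_ge_telescope:
  fixes f g :: "nat \<Rightarrow> real"
  assumes "summable f" and "\<And>n. g n - g (Suc n) \<le> f n" and "g \<longlonglongrightarrow> 0"
  shows "g 0 \<le> suminf f"
  using sums_le[OF assms(2) _ summable_sums[OF assms(1)]] telescope_sums'[OF assms(3)] by simp

text \<open>The left side is the integral of u^(-3/2) over [x, x+1]. Rationalizing turns comparisons
  with it into polynomial inequalities in the two square roots.\<close>

lemma inverse_diff_sqrt:
  assumes "0 < x"
  shows "2 / sqrt x - 2 / sqrt (x + 1) =
    2 / (sqrt x * sqrt (x + 1) * (sqrt x + sqrt (x + 1)))"
proof -
  have "(sqrt (x + 1) - sqrt x) * (sqrt x + sqrt (x + 1)) = 1"
    using assms by (simp add: algebra_simps)
  moreover have "sqrt x + sqrt (x + 1) \<noteq> 0"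
    using assms by (simp add: add_pos_pos less_imp_neq [symmetric])
  ultimately show ?thesis
    using assms by (simp add: divide_simps) (simp add: algebra_simps)
qed

text \<open>Midpoint rule for the convex function u^(-3/2) on [x - 1/2, x + 1/2]. In terms of roots
  it follows from the AM-GM inequality p q <= r^2 and its consequence p + q <= 2 r.\<close>

lemma three_halves_midpoint:
  assumes "1 / 2 < x"
  shows "1 / (x * sqrt x) \<le> 2 / sqrt (x - 1/2) - 2 / sqrt (x + 1/2)"
proof -
  define p q r where "p = sqrt (x - 1/2)" and "q = sqrt (x + 1/2)" and "r = sqrt x"
  have pos: "0 < p" "0 < q" "0 < r" using assms by (auto simp: p_def q_def r_def)
  have sq: "p\<^sup>2 = x - 1/2" "q\<^sup>2 = x + 1/2" "r\<^sup>2 = x" using assms by (auto simp: p_def q_def r_def)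
  have pq: "p * q \<le> r\<^sup>2"
    using sum_squares_bound[of p q] sq by simp
  have "(p + q)\<^sup>2 \<le> (2 * r)\<^sup>2"
    using pq sq by (simp add: power2_sum power_mult_distrib)
  then have "p + q \<le> 2 * r" by (rule power2_le_imp_le) (use pos in simp)
  then have "p * q * (p + q) \<le> r\<^sup>2 * (2 * r)"
    using pq pos by (intro mult_mono) auto
  then have "2 / (r\<^sup>2 * (2 * r)) \<le> 2 / (p * q * (p + q))"
    using pos by (intro divide_left_mono) auto
  then show ?thesis
    using inverse_diff_sqrt[of "x - 1/2"] assms sq by (simp add: p_def q_def r_def add.commute)
qed

lemma three_halves_trapezoid:
  assumes "0 < x"
  shows "2 / sqrt x - 2 / sqrt (x + 1) \<le> (1 / (x * sqrt x) + 1 / ((x + 1) * sqrt (x + 1))) / 2"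
proof -
  define p q where "p = sqrt x" and "q = sqrt (x + 1)"
  have pos: "0 < p" "0 < q" using assms by (auto simp: p_def q_def)
  have sq: "p\<^sup>2 = x" "q\<^sup>2 = x + 1" using assms by (auto simp: p_def q_def)
  \<comment> \<open>This is the claimed inequality with its denominators cleared, written as a sum
    of nonnegative terms.\<close>
  have "0 \<le> (p\<^sup>2 - q\<^sup>2)\<^sup>2 + p * q * (p - q)\<^sup>2"
    using pos by simp
  also have "\<dots> = (p + q) * (p ^ 3 + q ^ 3) - 4 * p\<^sup>2 * q\<^sup>2"
    by algebra
  finally have "2 / (p * q * (p + q)) \<le> (1 / (p\<^sup>2 * p) + 1 / (q\<^sup>2 * q)) / 2"
    using pos by (simp add: divide_simps add_pos_pos) (simp add: algebra_simps power_numeral_reduce)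
  then show ?thesis
    using inverse_diff_sqrt[OF assms] sq by (simp add: p_def q_def)
qed

text \<open>Midpoint rule for u^(-3). With y = x^2 - 1/4, the product of the endpoints, the integral
  is exactly x / y^2, and y <= x^2 gives the bound.\<close>

lemma cube_midpoint:
  fixes x :: real
  assumes "1 / 2 < x"
  shows "1 / x ^ 3 \<le> 1 / (2 * (x - 1/2)\<^sup>2) - 1 / (2 * (x + 1/2)\<^sup>2)"
proof -
  define y where "y = (x - 1/2) * (x + 1/2)"
  have "0 < y" unfolding y_def using assms by (intro mult_pos_pos) auto
  moreover have "y \<le> x\<^sup>2" by (simp add: y_def algebra_simps power2_eq_square)
  ultimately have y: "0 < y" "y \<le> x\<^sup>2" .
  have "y\<^sup>2 \<le> (x\<^sup>2)\<^sup>2" using y by (intro power_mono) auto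
  then have "y\<^sup>2 \<le> x * x ^ 3" by (simp add: power_numeral_reduce)
  then have "1 / x ^ 3 \<le> x / y\<^sup>2"
    using y assms by (simp add: divide_simps)
  also have "\<dots> = ((x + 1/2)\<^sup>2 - (x - 1/2)\<^sup>2) / (2 * ((x - 1/2)\<^sup>2 * (x + 1/2)\<^sup>2))"
  proof -
    have "(x + 1/2)\<^sup>2 - (x - 1/2)\<^sup>2 = 2 * x" by (simp add: power2_eq_square algebra_simps)
    then show ?thesis by (simp add: y_def power_mult_distrib)
  qed
  also have "\<dots> = 1 / (2 * (x - 1/2)\<^sup>2) - 1 / (2 * (x + 1/2)\<^sup>2)"
  proof -
    have "(b\<^sup>2 - a\<^sup>2) / (2 * (a\<^sup>2 * b\<^sup>2)) = 1 / (2 * a\<^sup>2) - 1 / (2 * b\<^sup>2)"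
      if "0 < a" "0 < b" for a b :: real
      using that by (simp add: field_simps)
    then show ?thesis using assms by simp
  qed
  finally show ?thesis .
qed

lemma cube_trapezoid:
  fixes x :: real
  assumes "0 < x"
  shows "1 / (2 * x\<^sup>2) - 1 / (2 * (x + 1)\<^sup>2) \<le> (1 / x ^ 3 + 1 / (x + 1) ^ 3) / 2"
proof -
  have "x * (x + 1) * (2 * x + 1) \<le> x ^ 3 + (x + 1) ^ 3"
    using assms by (simp add: power_numeral_reduce algebra_simps)
  moreover have "1 / (2 * x\<^sup>2) - 1 / (2 * (x + 1)\<^sup>2) =
      x * (x + 1) * (2 * x + 1) / (2 * (x ^ 3 * (x + 1) ^ 3))"
    using assms by (simp add: divide_simps) (simp add: power_numeral_reduce algebra_simps)
  moreover have "1 / x ^ 3 + 1 / (x + 1) ^ 3 = (x ^ 3 + (x + 1) ^ 3) / (x ^ 3 * (x + 1) ^ 3)"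
    using assms by (simp add: add_frac_eq ac_simps)
  ultimately show ?thesis
    using assms by (simp add: divide_right_mono mult.commute [of _ 2])
qed

lemma three_halves_tail:
  fixes a :: real
  assumes "1 / 2 < a"
  shows "summable (\<lambda>n. 1 / ((a + real n) * sqrt (a + real n)))" (is "summable ?f")
    and "(\<Sum>n. 1 / ((a + real n) * sqrt (a + real n))) \<le> 2 / sqrt (a - 1/2)"
    and "2 / sqrt a + 1 / (2 * (a * sqrt a)) \<le> (\<Sum>n. 1 / ((a + real n) * sqrt (a + real n)))"
proof -
  define g where "g n = 2 / sqrt (a + real n - 1/2)" for n
  \<comment> \<open>Summed trapezoids give the first term only weight 1/2 and every later term
    weight 1; \<open>?f n / 2\<close> restores the missing half.\<close>
  define h where "h n = 2 / sqrt (a + real n) + ?f n / 2" for n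
  have g: "g \<longlonglongrightarrow> 0" unfolding g_def by real_asymp
  have h: "h \<longlonglongrightarrow> 0" unfolding h_def by real_asymp
  have upper: "?f n \<le> g n - g (Suc n)" for n
    using three_halves_midpoint[of "a + real n"] assms by (simp add: g_def algebra_simps)
  have lower: "h n - h (Suc n) \<le> ?f n" for n
  proof -
    have "2 / sqrt (a + real n) - 2 / sqrt (a + real (Suc n)) \<le> (?f n + ?f (Suc n)) / 2"
      using three_halves_trapezoid[of "a + real n"] assms by (simp add: add_ac)
    then show ?thesis unfolding h_def add_divide_distrib by linarith
  qed
  show "summable ?f" and "suminf ?f \<le> 2 / sqrt (a - 1/2)"
    using suminf_le_telescope[OF _ upper g] assms by (auto simp: g_def)
  then show "2 / sqrt a + 1 / (2 * (a * sqrt a)) \<le> suminf ?f"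
    using suminf_ge_telescope[OF _ lower h] by (simp add: h_def mult.commute [of 2])
qed

lemma cube_tail:
  fixes a :: real
  assumes "1 / 2 < a"
  shows "summable (\<lambda>n. 1 / (a + real n) ^ 3)" (is "summable ?f")
    and "(\<Sum>n. 1 / (a + real n) ^ 3) \<le> 1 / (2 * (a - 1/2)\<^sup>2)"
    and "1 / (2 * a\<^sup>2) + 1 / (2 * a ^ 3) \<le> (\<Sum>n. 1 / (a + real n) ^ 3)"
proof -
  define g where "g n = 1 / (2 * (a + real n - 1/2)\<^sup>2)" for n
  define h where "h n = 1 / (2 * (a + real n)\<^sup>2) + 1 / (2 * (a + real n) ^ 3)" for n
  have g: "g \<longlonglongrightarrow> 0" unfolding g_def by real_asymp
  have h: "h \<longlonglongrightarrow> 0" unfolding h_def by real_asymp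
  have upper: "?f n \<le> g n - g (Suc n)" for n
    using cube_midpoint[of "a + real n"] assms by (simp add: g_def algebra_simps)
  have lower: "h n - h (Suc n) \<le> ?f n" for n
    using cube_trapezoid[of "a + real n"] assms by (simp add: h_def add_divide_distrib add_ac)
  show "summable ?f" and "suminf ?f \<le> 1 / (2 * (a - 1/2)\<^sup>2)"
    using suminf_le_telescope[OF _ upper g] assms by (auto simp: g_def)
  then show "1 / (2 * a\<^sup>2) + 1 / (2 * a ^ 3) \<le> suminf ?f"
    using suminf_ge_telescope[OF _ lower h] by (simp add: h_def)
qed

lemma powr_three_halves: "0 \<le> x \<Longrightarrow> x powr (3/2) = x * sqrt x"
proof -
  assume "0 \<le> x"
  have "x powr (3/2) = x powr (1 + 1/2)" by simp
  also have "\<dots> = x powr 1 * x powr (1/2)" by (rule powr_add)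
  finally show ?thesis using \<open>0 \<le> x\<close> by (simp add: powr_half_sqrt)
qed

lemma zeta_three_halves_sums: "(\<lambda>n. 1 / (real (Suc n) * sqrt (real (Suc n)))) sums zeta (3/2)"
  using summable_sums[OF three_halves_tail(1)[of 1]]
  by (simp add: zeta_def powr_three_halves add.commute)

lemma zeta_3_sums: "(\<lambda>n. 1 / real (Suc n) ^ 3) sums zeta 3"
  using summable_sums[OF cube_tail(1)[of 1]]
  by (simp add: zeta_def powr_numeral add.commute)

subsection \<open>Numerical evaluation\<close>

text \<open>The table \<open>qs\<close> brackets each of the first 100 terms within 10^(-8), and
  \<open>three_halves_tail\<close> brackets the rest.\<close>

lemma zeta_three_halves_bounds: "2.612373 \<le> zeta (3/2)" "zeta (3/2) \<le> 2.612377"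
proof -
  \<comment> \<open>\<open>qs ! n = \<lfloor>10 ^ 8 * (n + 1) powr (-3/2)\<rfloor>\<close>\<close>
  define qs :: "nat list" where "qs = [
    100000000, 35355339, 19245008, 12500000, 8944271, 6804138, 5399492, 4419417, 3703703,
    3162277, 2741012, 2405626, 2133462, 1909008, 1721325, 1562500, 1426680, 1309457, 1207451,
    1118033, 1039132, 969094, 906584, 850517, 800000, 754292, 712778, 674936, 640328, 608580,
    579371, 552427, 527508, 504407, 482945, 462962, 444321, 426898, 410585, 395284, 380911,
    367388, 354647, 342626, 331269, 320525, 310351, 300703, 291545, 282842, 274564, 266682,
    259170, 252005, 245163, 238626, 232374, 226390, 220659, 215165, 209896, 204838, 199981,
    195312, 190822, 186502, 182342, 178335, 174472, 170746, 167152, 163682, 160330, 157091,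
    153960, 150931, 148000, 145163, 142416, 139754, 137174, 134672, 132246, 129891, 127606,
    125386, 123231, 121136, 119100, 117121, 115196, 113323, 111500, 109725, 107997, 106314,
    104674, 103076, 101518, 100000]"
  define f where "f n = 1 / (real (Suc n) * sqrt (real (Suc n)))" for n
  have [simp]: "length qs = 100" by (simp add: qs_def)
  \<comment> \<open>Squaring q / 10^8 <= n^(-3/2) <= (q + 1) / 10^8 leaves inequalities between
    integers, which are checked by evaluation.\<close>
  have *: "\<forall>(n, q) \<in> set (zip (1 # [2..<101]) qs).
      q\<^sup>2 * n ^ 3 \<le> 10 ^ 16 \<and> 10 ^ 16 \<le> (q + 1)\<^sup>2 * n ^ 3"
    by (simp add: qs_def upt_rec_numeral)
  have qs: "(qs ! n)\<^sup>2 * Suc n ^ 3 \<le> 10 ^ 16 \<and> 10 ^ 16 \<le> (qs ! n + 1)\<^sup>2 * Suc n ^ 3"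
    if "n < 100" for n
  proof -
    have "(1 # [2..<101]) ! n = Suc n"
      using that by (cases n) (simp_all add: nth_upt del: upt_rec_numeral)
    then have "(Suc n, qs ! n) \<in> set (zip (1 # [2..<101]) qs)"
      using that by (force simp: set_zip)
    with * show ?thesis by blast
  qed
  have f: "real (qs ! n) / 10 ^ 8 \<le> f n \<and> f n \<le> real (qs ! n + 1) / 10 ^ 8" if "n < 100" for n
  proof -
    have f2: "(f n)\<^sup>2 = 1 / real (Suc n ^ 3)"
      by (simp add: f_def power_divide power_mult_distrib del: of_nat_Suc)
        (simp add: power_numeral_reduce del: of_nat_Suc)
    have "real ((qs ! n)\<^sup>2 * Suc n ^ 3) \<le> real (10 ^ 16)"
      "real (10 ^ 16) \<le> real ((qs ! n + 1)\<^sup>2 * Suc n ^ 3)"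
      using qs[OF that] by (simp_all only: of_nat_le_iff)
    then have squares: "(real (qs ! n) / 10 ^ 8)\<^sup>2 \<le> (f n)\<^sup>2"
      "(f n)\<^sup>2 \<le> (real (qs ! n + 1) / 10 ^ 8)\<^sup>2"
      unfolding f2 by (simp_all add: field_simps del: of_nat_Suc)
    show ?thesis
      by (rule conjI; rule power2_le_imp_le) (fact squares | simp add: f_def)+
  qed
  have "(\<Sum>n<100. qs ! n) = sum_list qs"
    by (simp add: sum_list_sum_nth atLeast0LessThan)
  also have "\<dots> = 241287364" by (simp add: qs_def)
  finally have sum: "(\<Sum>n<100. real (qs ! n)) = 241287364"
    by (simp flip: of_nat_sum)
  have "(\<Sum>n<100. real (qs ! n) / 10 ^ 8) \<le> (\<Sum>n<100. f n)"
    "(\<Sum>n<100. f n) \<le> (\<Sum>n<100. real (qs ! n + 1) / 10 ^ 8)"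
    using f by (auto intro!: sum_mono)
  then have head: "2.41287364 \<le> (\<Sum>n<100. f n)" "(\<Sum>n<100. f n) \<le> 2.41287464"
    by (simp_all add: sum sum.distrib flip: sum_divide_distrib)
  have zeta: "zeta (3/2) = (\<Sum>n. f (n + 100)) + (\<Sum>n<100. f n)"
    using zeta_three_halves_sums suminf_split_initial_segment[of f 100]
    by (simp add: sums_iff f_def [abs_def] del: of_nat_Suc)
  \<comment> \<open>Since \<open>f\<close> is indexed from 0, the tail begins at the integer 101,
    and the midpoint bound at 101 - 1/2.\<close>
  have tail: "(\<Sum>n. f (n + 100)) \<le> 2 / sqrt 100.5"
    "2 / sqrt 101 + 1 / (202 * sqrt 101) \<le> (\<Sum>n. f (n + 100))"
    using three_halves_tail(2,3)[of 101] by (simp_all add: f_def add_ac)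
  have "10.02496 \<le> sqrt 100.5" by (rule real_le_rsqrt) (simp add: power2_eq_square)
  then have "2 / sqrt 100.5 \<le> 2 / 10.02496" by (intro divide_left_mono) auto
  then show "zeta (3/2) \<le> 2.612377" using zeta tail head by simp
  have "sqrt 101 \<le> 10.049876" by (rule real_le_lsqrt) (simp_all add: power2_eq_square)
  then have "2 / 10.049876 + 1 / (202 * 10.049876) \<le> 2 / sqrt 101 + 1 / (202 * sqrt 101)"
    by (intro add_mono divide_left_mono) auto
  then show "2.612373 \<le> zeta (3/2)" using zeta tail head by simp
qed

text \<open>After 20 terms the two tail bounds already differ by only about 2 * 10^(-6).\<close>

lemma zeta_3_bounds: "1.202055 \<le> zeta 3" "zeta 3 \<le> 1.202058"
proof -
  define f where "f n = 1 / real (Suc n) ^ 3" for n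
  have zeta: "zeta 3 = (\<Sum>n. f (n + 20)) + (\<Sum>n<20. f n)"
    using zeta_3_sums suminf_split_initial_segment[of f 20]
    by (simp add: sums_iff f_def [abs_def] del: of_nat_Suc)
  have tail: "(\<Sum>n. f (n + 20)) \<le> 1 / (2 * 20.5\<^sup>2)"
    "1 / (2 * 21\<^sup>2) + 1 / (2 * 21 ^ 3) \<le> (\<Sum>n. f (n + 20))"
    using cube_tail(2,3)[of 21] by (simp_all add: f_def add_ac)
  have head: "1.2008678419 \<le> (\<Sum>n<20. f n)" "(\<Sum>n<20. f n) \<le> 1.2008678420"
    by (simp_all add: f_def lessThan_nat_numeral lessThan_Suc)
  show "1.202055 \<le> zeta 3" "zeta 3 \<le> 1.202058"
    using zeta tail head by (simp_all add: power2_eq_square power_numeral_reduce)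
qed

lemma golomb_const_bounds: "\<bar>golomb_const - 2.1733\<bar> \<le> 0.00005"
proof -
  \<comment> \<open>The constant is about 2.173254, barely above the lower rounding limit 2.17325
    for 2.1733. This is why both zeta values are needed to about six decimals.\<close>
  have "2.17325 * zeta 3 \<le> zeta (3/2)" "zeta (3/2) \<le> 2.17335 * zeta 3"
    using zeta_three_halves_bounds zeta_3_bounds by simp_all
  then have "2.17325 \<le> golomb_const" "golomb_const \<le> 2.17335"
    using zeta_3_bounds by (simp_all add: golomb_const_def field_simps)
  then show ?thesis by (intro abs_leI) simp_all
qed

subsection \<open>Squarefree parts and powerful numbers\<close>

text \<open>If the square part were k j, then j^2 would divide the squarefree b, so j = 1. Hence k,
  and with it b, can be recovered from b k^2.\<close>

lemma square_part_squarefree_mult_square: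
  fixes b k :: nat
  assumes "squarefree b" and "0 < k"
  shows "square_part (b * k\<^sup>2) = k"
proof -
  have "k dvd square_part (b * k\<^sup>2)"
    by (simp add: dvd_square_part_iff)
  then obtain j where j: "square_part (b * k\<^sup>2) = k * j" ..
  have "(k * j)\<^sup>2 dvd b * k\<^sup>2"
    using square_part_square_dvd[of "b * k\<^sup>2"] by (simp add: j)
  then have "j\<^sup>2 dvd b"
    using assms by (simp add: power_mult_distrib mult.commute)
  then have "j = 1"
    using squarefreeD[OF assms(1)] by fastforce
  then show ?thesis using j by simp
qed

text \<open>Serves twice: for uniqueness in the parametrization of powerful numbers, and for
  factoring the series of zeta(3/2).\<close>

lemma bij_betw_squarefree_mult_square:
  "bij_betw (\<lambda>(b, m). b * m\<^sup>2) ({b::nat. squarefree b} \<times> {0<..}) {0<..}"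
  unfolding bij_betw_def
proof
  show "inj_on (\<lambda>(b, m). b * m\<^sup>2) ({b::nat. squarefree b} \<times> {0<..})"
  proof (rule inj_onI, clarsimp)
    fix b m b' m' :: nat
    assume *: "squarefree b" "0 < m" "squarefree b'" "0 < m'" and eq: "b * m\<^sup>2 = b' * m'\<^sup>2"
    have "m = m'"
      using square_part_squarefree_mult_square[OF *(1,2)] square_part_squarefree_mult_square[OF *(3,4)] eq
      by simp
    then show "b = b' \<and> m = m'" using eq * by simp
  qed
  show "(\<lambda>(b, m). b * m\<^sup>2) ` ({b::nat. squarefree b} \<times> {0<..}) = {0<..}"
  proof (intro equalityI subsetI)
    fix n :: nat assume "n \<in> {0<..}"
    then show "n \<in> (\<lambda>(b, m). b * m\<^sup>2) ` ({b. squarefree b} \<times> {0<..})"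
      using squarefree_decompose[of n]
      by (intro image_eqI[of _ _ "(squarefree_part n, square_part n)"]) (auto intro!: gr0I)
  qed (auto intro: gr0I)
qed

lemma powerful_cube_mult_square:
  assumes "0 < b" and "0 < m"
  shows "powerful (b ^ 3 * m\<^sup>2)"
  unfolding powerful_def
proof (intro conjI allI impI)
  fix p assume "prime p \<and> p dvd b ^ 3 * m\<^sup>2"
  then have "p dvd b \<or> p dvd m"
    by (auto simp: prime_dvd_mult_iff prime_dvd_power_iff)
  then show "p\<^sup>2 dvd b ^ 3 * m\<^sup>2"
  proof
    assume "p dvd b"
    then have "p\<^sup>2 dvd b\<^sup>2" by (rule dvd_power_same)
    then have "p\<^sup>2 dvd b\<^sup>2 * (b * m\<^sup>2)" by (rule dvd_mult2)
    then show ?thesis by (simp add: power_numeral_reduce mult_ac)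
  qed (simp add: dvd_power_same)
qed (use assms in simp)

text \<open>At a prime of multiplicity e in \<open>a\<close>, the squarefree part has exponent e mod
  2 and the square part e div 2. The former exceeds the latter only for e = 1, which is excluded for
  powerful \<open>a\<close>.\<close>

lemma powerful_squarefree_part_dvd:
  assumes "powerful a"
  shows "squarefree_part a dvd square_part a"
proof -
  have a: "a \<noteq> 0" using assms by (auto simp: powerful_def)
  have "multiplicity p (squarefree_part a) \<le> multiplicity p (square_part a)" if p: "prime p" for p
  proof -
    have "multiplicity p a \<noteq> 1"
    proof
      assume 1: "multiplicity p a = 1"
      then have "p\<^sup>2 dvd a"
        using assms p by (metis not_dvd_imp_multiplicity_0 powerful_def zero_neq_one)
      then show False
        using 1 a p by (subst (asm) power_dvd_iff_le_multiplicity) auto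
    qed
    then show ?thesis
      using p by (simp add: prime_multiplicity_squarefree_part prime_multiplicity_square_part; presburger)
  qed
  then show ?thesis
    using a by (subst prime_multiplicity_le_imp_dvd) auto
qed

text \<open>Writing b^3 m^2 = b (b m)^2 reduces uniqueness to the squarefree decomposition.
  Surjectivity holds because the square part of a powerful number is a multiple of its squarefree
  part.\<close>

lemma bij_betw_powerful:
  "bij_betw (\<lambda>(b, m). b ^ 3 * m\<^sup>2) ({b. squarefree b} \<times> {0<..}) {a. powerful a}"
  unfolding bij_betw_def
proof
  let ?A = "{b::nat. squarefree b} \<times> {0<..}"
  have pos: "0 < b" if "squarefree b" for b :: nat
    using that by (intro gr0I) auto
  have eq: "b ^ 3 * m\<^sup>2 = b * (b * m)\<^sup>2" for b m :: nat
    by (simp add: power_numeral_reduce mult_ac)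
  show "inj_on (\<lambda>(b, m). b ^ 3 * m\<^sup>2) ?A"
  proof (rule inj_onI, clarsimp)
    fix b m b' m' :: nat
    assume *: "squarefree b" "0 < m" "squarefree b'" "0 < m'" "b ^ 3 * m\<^sup>2 = b' ^ 3 * m'\<^sup>2"
    then have "(b, b * m) = (b', b' * m')"
      using bij_betw_imp_inj_on[OF bij_betw_squarefree_mult_square]
      by (intro inj_onD[of "\<lambda>(b, m). b * m\<^sup>2"]) (auto simp: eq pos)
    then show "b = b' \<and> m = m'" using pos[OF \<open>squarefree b\<close>] by auto
  qed
  show "(\<lambda>(b, m). b ^ 3 * m\<^sup>2) ` ?A = {a. powerful a}"
  proof (intro equalityI subsetI)
    fix a assume "a \<in> {a. powerful a}"
    then have a: "powerful a" "0 < a" by (auto simp: powerful_def)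
    obtain m where m: "square_part a = squarefree_part a * m"
      using powerful_squarefree_part_dvd[OF a(1)] ..
    then have "a = squarefree_part a ^ 3 * m\<^sup>2"
      using squarefree_decompose[of a] by (simp add: eq)
    moreover from this have "0 < m" using a(2) by (intro gr0I) auto
    ultimately show "a \<in> (\<lambda>(b, m). b ^ 3 * m\<^sup>2) ` ?A"
      by (intro image_eqI[of _ _ "(squarefree_part a, m)"]) auto
  qed (auto intro: powerful_cube_mult_square pos)
qed

subsection \<open>Golomb's constant as a sum over squarefree numbers\<close>

text \<open>Since (b m^2)^(-3/2) = b^(-3/2) m^(-3), summing over all n = b m^2 shows that zeta(3/2)
  is the squarefree sum times zeta(3).\<close>

lemma squarefree_three_halves_has_sum:
  "((\<lambda>b. 1 / (real b * sqrt (real b))) has_sum golomb_const) {b. squarefree b}"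
proof -
  define f where "f n = 1 / (real n * sqrt (real n))" for n
  have pos_has_sum: "(g has_sum s) {0<..}" if "(\<lambda>n. g (Suc n)) sums s" "\<And>n. 0 \<le> g n"
    for g :: "nat \<Rightarrow> real" and s
    using sums_nonneg_imp_has_sum[OF that(1)] that(2)
    by (simp add: greaterThan_0 has_sum_reindex comp_def)
  have f: "(f has_sum zeta (3/2)) {0<..}"
    using zeta_three_halves_sums by (intro pos_has_sum) (simp_all add: f_def)
  have cube: "((\<lambda>m. 1 / real m ^ 3) has_sum zeta 3) {0<..}"
    using zeta_3_sums by (intro pos_has_sum) simp_all
  have mult: "f (b * m\<^sup>2) = f b * (1 / real m ^ 3)" for b m
    by (simp add: f_def real_sqrt_mult power_numeral_reduce)
  have "((\<lambda>p. f (case p of (b, m) \<Rightarrow> b * m\<^sup>2)) has_sum zeta (3/2)) ({b. squarefree b} \<times> {0<..})"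
    using f by (simp add: has_sum_reindex_bij_betw[OF bij_betw_squarefree_mult_square])
  then have "((\<lambda>b. f b * zeta 3) has_sum zeta (3/2)) {b. squarefree b}"
    by (rule has_sum_SigmaD) (simp add: mult has_sum_cmult_right [OF cube] del: times_divide_eq_right)
  then have "(f has_sum golomb_const) {b. squarefree b}"
    using zeta_3_bounds by (simp add: has_sum_cmult_left_iff golomb_const_def)
  then show ?thesis by (simp add: f_def [abs_def])
qed

subsection \<open>Counting powerful numbers\<close>

lemma card_pos_nat_le:
  assumes "0 \<le> y"
  shows "card {m. 0 < m \<and> real m \<le> y} = nat \<lfloor>y\<rfloor>"
proof -
  have "{m. 0 < m \<and> real m \<le> y} = {1..nat \<lfloor>y\<rfloor>}"
    using assms by (auto simp: le_nat_iff le_floor_iff Suc_le_eq)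
  then show ?thesis by simp
qed

lemma finite_nat_le_real: "finite {b. P b \<and> real b \<le> x}"
  by (rule finite_subset[of _ "{..nat \<lfloor>x\<rfloor>}"]) (auto simp: le_nat_floor)

lemma kappa_eq_sum_floor:
  assumes "0 \<le> t"
  shows "kappa t = (\<Sum>b | squarefree b \<and> real b \<le> t powr (1/3).
    nat \<lfloor>sqrt t * (1 / (real b * sqrt (real b)))\<rfloor>)"
proof -
  let ?B = "{b::nat. squarefree b \<and> real b \<le> t powr (1/3)}"
  let ?v = "\<lambda>b. sqrt t * (1 / (real b * sqrt (real b)))"
  let ?f = "\<lambda>(b, m). b ^ 3 * m\<^sup>2 :: nat"
  define S where "S = (SIGMA b:?B. {m. 0 < m \<and> real m \<le> ?v b})"
  have pos: "0 < b" if "squarefree b" for b :: nat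
    using that by (intro gr0I) auto
  have le: "real (b ^ 3 * m\<^sup>2) \<le> t \<longleftrightarrow> real m \<le> ?v b" if "0 < b" for b m
  proof -
    have "sqrt (real (b ^ 3 * m\<^sup>2)) = real m * (real b * sqrt (real b))"
      by (simp add: real_sqrt_mult power_numeral_reduce)
    then have "real (b ^ 3 * m\<^sup>2) \<le> t \<longleftrightarrow> real m * (real b * sqrt (real b)) \<le> sqrt t"
      by (metis real_sqrt_le_iff)
    also have "\<dots> \<longleftrightarrow> real m \<le> ?v b"
      using that by (simp add: field_simps)
    finally show ?thesis .
  qed
  \<comment> \<open>Because m >= 1, only b up to the cube root of t contribute, so the sum over b is
    finite.\<close>
  have root: "real b \<le> t powr (1/3)" if "0 < b" "0 < m" "real (b ^ 3 * m\<^sup>2) \<le> t" for b m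
  proof -
    have "b ^ 3 \<le> b ^ 3 * m\<^sup>2" using that by simp
    then have "real (b ^ 3) \<le> t" using that by linarith
    then have "real (b ^ 3) powr (1/3) \<le> t powr (1/3)"
      by (intro powr_mono2) auto
    moreover have "real (b ^ 3) powr (1/3) = real b"
      using that by (simp add: powr_powr flip: powr_numeral)
    ultimately show ?thesis by simp
  qed
  have S: "S = {(b, m). squarefree b \<and> 0 < m \<and> real (b ^ 3 * m\<^sup>2) \<le> t}"
    unfolding set_eq_iff split_paired_All S_def mem_Sigma_iff mem_Collect_eq case_prod_conv
    using root le pos by metis
  have inj: "inj_on ?f S"
    by (rule inj_on_subset[OF bij_betw_imp_inj_on[OF bij_betw_powerful]]) (auto simp: S)
  have "?f ` S = {a. powerful a \<and> 1 \<le> real a \<and> real a \<le> t}"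
  proof (intro equalityI subsetI)
    fix a assume "a \<in> ?f ` S"
    then obtain b m where "squarefree b" "0 < m" "a = b ^ 3 * m\<^sup>2" "real a \<le> t"
      by (auto simp: S)
    moreover from this have "powerful a" by (simp add: powerful_cube_mult_square pos)
    ultimately show "a \<in> {a. powerful a \<and> 1 \<le> real a \<and> real a \<le> t}"
      by (simp add: powerful_def)
  next
    fix a assume a: "a \<in> {a. powerful a \<and> 1 \<le> real a \<and> real a \<le> t}"
    then have "a \<in> ?f ` ({b. squarefree b} \<times> {0<..})"
      by (simp only: bij_betw_imp_surj_on[OF bij_betw_powerful] mem_Collect_eq)
    then obtain b m where "squarefree b" "0 < m" "a = b ^ 3 * m\<^sup>2"
      by clarsimp
    then show "a \<in> ?f ` S"
      using a by (intro image_eqI[of _ _ "(b, m)"]) (simp_all add: S)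
  qed
  then have "kappa t = card (?f ` S)" by (simp only: kappa_def)
  also have "\<dots> = card S" using inj by (rule card_image)
  also have "\<dots> = (\<Sum>b\<in>?B. card {m. 0 < m \<and> real m \<le> ?v b})"
    unfolding S_def by (rule card_SigmaI) (auto intro: finite_nat_le_real)
  also have "\<dots> = (\<Sum>b\<in>?B. nat \<lfloor>?v b\<rfloor>)"
    using assms by (intro sum.cong card_pos_nat_le) auto
  finally show ?thesis .
qed

text \<open>Dropping the floors and extending the sum to all squarefree b can only increase
  it.\<close>

lemma kappa_le:
  assumes "0 \<le> t"
  shows "real (kappa t) \<le> golomb_const * sqrt t"
proof -
  let ?B = "{b::nat. squarefree b \<and> real b \<le> t powr (1/3)}"
  let ?v = "\<lambda>b. 1 / (real b * sqrt (real b))"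
  have "real (kappa t) \<le> (\<Sum>b\<in>?B. sqrt t * ?v b)"
    unfolding kappa_eq_sum_floor[OF assms] of_nat_sum using assms by (intro sum_mono) simp
  also have "\<dots> = sqrt t * (\<Sum>b\<in>?B. ?v b)"
    by (simp add: sum_distrib_left)
  also have "\<dots> \<le> sqrt t * golomb_const"
    using assms by (intro mult_left_mono finite_sum_le_has_sum[OF squarefree_three_halves_has_sum])
      (auto intro: finite_nat_le_real)
  finally show ?thesis by (simp add: mult.commute)
qed

text \<open>The squarefree terms beyond \<open>M\<close> are bounded by the sum over all integers
  beyond \<open>M\<close>, whose midpoint bound starts at M + 1 - 1/2.\<close>

lemma golomb_const_le_partial_sum:
  "golomb_const \<le> (\<Sum>b | squarefree b \<and> b \<le> M. 1 / (real b * sqrt (real b))) + 2 / sqrt (real M + 1/2)"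
proof -
  let ?B = "{b::nat. squarefree b \<and> b \<le> M}"
  let ?v = "\<lambda>b. 1 / (real b * sqrt (real b))"
  define T where "T = (\<Sum>n. 1 / ((real M + 1 + real n) * sqrt (real M + 1 + real n)))"
  have "((\<lambda>n. ?v (n + Suc M)) has_sum T) UNIV"
    using summable_sums[OF three_halves_tail(1)[of "real M + 1"]]
    by (intro sums_nonneg_imp_has_sum) (simp_all add: T_def add_ac)
  moreover have "bij_betw (\<lambda>n. n + Suc M) UNIV {M<..}"
    by (rule bij_betw_byWitness[where f' = "\<lambda>n. n - Suc M"]) auto
  ultimately have T: "(?v has_sum T) {M<..}"
    by (simp only: has_sum_reindex_bij_betw[where f = ?v])
  have "finite ?B" by simp
  then have "(?v has_sum golomb_const - sum ?v ?B) ({b. squarefree b} - ?B)"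
    by (intro has_sum_Diff squarefree_three_halves_has_sum) auto
  then have "golomb_const - sum ?v ?B \<le> T"
    using T by (rule has_sum_mono_neutral) auto
  also have "T \<le> 2 / sqrt (real M + 1/2)"
    using three_halves_tail(2)[of "real M + 1"] by (simp add: T_def add.commute)
  finally show ?thesis by simp
qed

text \<open>For x = t^(1/3) the left side is the total error in the lower bound: sqrt t times the
  tail estimate, plus at most 1 for each of at most \<open>M\<close> floors.\<close>

lemma golomb_error_le:
  fixes x :: real
  assumes "real M \<le> x" and "x < real M + 1"
  shows "x * sqrt x * (2 / sqrt (real M + 1/2)) + real M \<le> 3 * x"
proof -
  define y where "y = real M + 1/2"
  have y: "1/2 \<le> y" "0 \<le> x" using assms by (auto simp: y_def)
  \<comment> \<open>AM-GM removes the root. What remains is equivalent to (x - y)^2 <= y / 2, which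
    holds since y is the midpoint of [M, M + 1], an interval containing x, and y >= 1/2.\<close>
  have "sqrt (x / y) \<le> (x / y + 1) / 2"
    using arith_geo_mean_sqrt[of "x / y" 1] y by simp
  then have "2 * x * sqrt (x / y) \<le> 2 * x * ((x / y + 1) / 2)"
    using y by (intro mult_left_mono) auto
  also have "\<dots> + y - 1/2 \<le> 3 * x"
  proof -
    have "\<bar>x - y\<bar> \<le> 1/2" using assms unfolding y_def by linarith
    then have "\<bar>x - y\<bar>\<^sup>2 \<le> (1/2)\<^sup>2" by (intro power_mono) auto
    then have "(x - y)\<^sup>2 \<le> 1/4" by (simp add: power2_eq_square)
    also have "\<dots> \<le> y / 2" using y by simp
    finally have "x * x + y * y - y / 2 \<le> 2 * x * y" by (simp add: power2_eq_square algebra_simps)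
    then show ?thesis using y by (simp add: field_simps)
  qed
  finally show ?thesis by (simp add: y_def real_sqrt_divide mult_ac)
qed

lemma kappa_ge:
  assumes "1 \<le> t"
  shows "golomb_const * sqrt t - 3 * t powr (1/3) \<le> real (kappa t)"
proof -
  define x where "x = t powr (1/3)"
  define M where "M = nat \<lfloor>x\<rfloor>"
  let ?B = "{b::nat. squarefree b \<and> b \<le> M}"
  let ?v = "\<lambda>b. 1 / (real b * sqrt (real b))"
  have x: "0 \<le> x" by (simp add: x_def)
  then have M: "real M \<le> x" "x < real M + 1" by (simp_all add: M_def)
  have B: "{b. squarefree b \<and> real b \<le> x} = ?B"
    using x by (auto simp: M_def le_nat_iff le_floor_iff)
  have "sqrt t = x powr (3/2)"
    using assms by (simp add: x_def powr_powr powr_half_sqrt)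
  then have t: "sqrt t = x * sqrt x" using x by (simp add: powr_three_halves)
  have "card ?B \<le> card {1..M}"
    by (intro card_mono) (auto simp: Suc_le_eq intro!: gr0I)
  then have card: "real (card ?B) \<le> real M" by simp
  have "golomb_const * sqrt t \<le> (sum ?v ?B + 2 / sqrt (real M + 1/2)) * sqrt t"
    using assms by (intro mult_right_mono golomb_const_le_partial_sum) auto
  \<comment> \<open>Taking 1 off each summand puts it below its floor; the total taken off is
    returned as \<open>card ?B\<close>.\<close>
  also have "\<dots> = (\<Sum>b\<in>?B. sqrt t * ?v b - 1) + x * sqrt x * (2 / sqrt (real M + 1/2)) + real (card ?B)"
    by (simp add: sum_subtractf t ring_distribs mult_ac del: times_divide_eq_right flip: sum_distrib_left)
  also have "\<dots> \<le> (\<Sum>b\<in>?B. sqrt t * ?v b - 1) + 3 * x"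
    using golomb_error_le[OF M] card by linarith
  also have "(\<Sum>b\<in>?B. sqrt t * ?v b - 1) \<le> real (kappa t)"
    using assms unfolding kappa_eq_sum_floor[OF order.trans[OF zero_le_one assms]] of_nat_sum
      x_def [symmetric] B
    by (intro sum_mono) linarith
  finally show ?thesis by (simp add: x_def)
qed

lemma kappa_over_t_tendsto_0: "((\<lambda>t. real (kappa t) / t) \<longlongrightarrow> 0) at_top"
proof (rule tendsto_sandwich)
  show "\<forall>\<^sub>F t in at_top. 0 \<le> real (kappa t) / t"
    using eventually_ge_at_top[of 0] by eventually_elim simp
  show "\<forall>\<^sub>F t in at_top. real (kappa t) / t \<le> golomb_const * sqrt t / t"
    using eventually_ge_at_top[of 0] by eventually_elim (intro divide_right_mono kappa_le)
  show "((\<lambda>t. golomb_const * sqrt t / t) \<longlongrightarrow> 0) at_top" by real_asymp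
qed simp

subsection \<open>Differences of coprime integers\<close>

text \<open>Coprimality imposes no restriction on the difference: l = \<open>\<delta>\<close> + 1
  and m = 1 always work, and any other choice of m only makes l larger.\<close>

lemma Delta_eq: "Delta t = {\<delta>. powerful \<delta> \<and> real \<delta> + 1 \<le> t}"
proof (intro equalityI subsetI)
  fix \<delta> assume "\<delta> \<in> Delta t"
  then obtain l m :: int where lm: "int \<delta> = l - m" "1 \<le> m" "real_of_int l \<le> t" "powerful \<delta>"
    by (auto simp: Delta_def)
  then have "int \<delta> + 1 \<le> l" by simp
  then have "real \<delta> + 1 \<le> real_of_int l" by linarith
  then show "\<delta> \<in> {\<delta>. powerful \<delta> \<and> real \<delta> + 1 \<le> t}" using lm by simp
next
  fix \<delta> assume *: "\<delta> \<in> {\<delta>. powerful \<delta> \<and> real \<delta> + 1 \<le> t}"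
  then have "0 < \<delta>" by (simp add: powerful_def)
  with * show "\<delta> \<in> Delta t"
    unfolding Delta_def by (intro CollectI exI[of _ "int \<delta> + 1"] exI[of _ 1]) simp
qed

lemma card_Delta:
  assumes "1 \<le> t"
  shows "if powerful (nat \<lfloor>t\<rfloor>) then card (Delta t) + 1 = kappa t else card (Delta t) = kappa t"
proof -
  define n where "n = nat \<lfloor>t\<rfloor>"
  have n: "real a \<le> t \<longleftrightarrow> a \<le> n" for a
    using assms by (simp add: n_def le_nat_iff le_floor_iff)
  \<comment> \<open>The inequality is strict because l must be at least a + 1, so \<open>n\<close>
    itself is never a difference although \<open>kappa\<close> may count it.\<close>
  have "real a + 1 \<le> t \<longleftrightarrow> a < n" for a
    using n[of "Suc a"] by (simp add: Suc_le_eq add.commute)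
  then have Delta: "Delta t = {a. powerful a \<and> a < n}"
    by (simp add: Delta_eq)
  have "{a. powerful a \<and> 1 \<le> real a \<and> real a \<le> t} = {a. powerful a \<and> a \<le> n}"
    by (auto simp: n powerful_def)
  also have "\<dots> = (if powerful n then insert n (Delta t) else Delta t)"
    by (auto simp: Delta order.order_iff_strict)
  finally show ?thesis
    by (simp add: kappa_def Delta flip: n_def)
qed

lemma Delta_over_t_tendsto_0: "((\<lambda>t. real (card (Delta t)) / t) \<longlongrightarrow> 0) at_top"
proof (rule tendsto_sandwich)
  show "\<forall>\<^sub>F t in at_top. 0 \<le> real (card (Delta t)) / t"
    using eventually_ge_at_top[of 0] by eventually_elim simp
  show "\<forall>\<^sub>F t in at_top. real (card (Delta t)) / t \<le> real (kappa t) / t"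
    using eventually_ge_at_top[of 1]
  proof eventually_elim
    case (elim t)
    then have "card (Delta t) \<le> kappa t"
      using card_Delta[of t] by (auto split: if_splits)
    then show ?case using elim by (simp add: divide_right_mono)
  qed
qed (simp_all add: kappa_over_t_tendsto_0)

theorem mainTheorem6:
  shows "(\<forall>t::real. t \<ge> 1 \<longrightarrow>
            golomb_const * t powr (1/2) - 3 * t powr (1/3) \<le> real (kappa t) \<and>
            real (kappa t) \<le> golomb_const * t powr (1/2)) \<and>
         \<bar>golomb_const - 2.1733\<bar> \<le> 0.00005 \<and>
         ((\<lambda>t. real (kappa t) / t) \<longlongrightarrow> 0) at_top \<and>
         (\<forall>t::real. t \<ge> 1 \<longrightarrow>
            (if powerful (nat \<lfloor>t\<rfloor>) then card (Delta t) + 1 = kappa t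
             else card (Delta t) = kappa t)) \<and>
         ((\<lambda>t. real (card (Delta t)) / t) \<longlongrightarrow> 0) at_top"
proof (intro conjI allI impI)
  fix t :: real assume "1 \<le> t"
  then show "golomb_const * t powr (1/2) - 3 * t powr (1/3) \<le> real (kappa t)"
    and "real (kappa t) \<le> golomb_const * t powr (1/2)"
    using kappa_ge[of t] kappa_le[of t] by (simp_all add: powr_half_sqrt)
qed (rule golomb_const_bounds kappa_over_t_tendsto_0 Delta_over_t_tendsto_0
      | erule card_Delta)+

end
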